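(* Let $(X_n)_{n\ge0}$ be the two-armed bandit algorithm with $p_A=p_B=1$ and steps $\gamma_n=\Delta_n/S_n$, where $\Delta_0=1$, $\Delta_n>0$ and $S_n=\sum_{k=0}^n\Delta_k$ (see the context), and let $X_\infty$ be the a.s. limit of $X_n$. Assume that the sequence $(\Delta_n)_{n\ge1}$ is nonincreasing ($\Delta_1$ may be greater than $\Delta_0=1$). (a) For every $x\in[0,1]$ and every integer $m\ge1$, $$\mathbb{E}_x(X_\infty^{m+1})\le\prod_{k=0}^m\left(1-\frac{1-x}{S_k}\right)\quad\text{and}\quad\mathbb{E}_x\big((1-X_\infty)^{m+1}\big)\le\prod_{k=0}^m\left(1-\frac{x}{S_k}\right).$$ In particular, for every $x\in(0,1)$, $\mathbb{P}_x(X_\infty=1)\le\inf_m\mathbb{E}_x(X_\infty^m)=0$ and $\mathbb{P}_x(X_\infty=0)\le\inf_m\mathbb{E}_x((1-X_\infty)^m)=0$. (b) If, moreover, $\Delta_n=\Delta>0$ for all $n\ge1$ (and $\Delta_0=1$), then $\gamma_n=\frac{\Delta}{n\Delta+1}$ and, for $x\in(0,1)$, under $\mathbb{P}_x$ the random variable $X_\infty$ has the Beta distribution $\beta\left(\frac x\Delta;\frac{1-x}\Delta\right)$.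
   Context: Two-armed bandit algorithm with $p_A=p_B=1$: let $(U_n)_{n\ge1}$ be i.i.d. random variables uniformly distributed on $[0,1]$; the steps satisfy $\gamma_n\in(0,1)$ and $\sum_n\gamma_n=+\infty$. The algorithm starting from $x\in[0,1]$ is defined by $X_0=x$ and, for $n\ge0$, $X_{n+1}=X_n+\gamma_{n+1}(\mathbf 1_{\{U_{n+1}\le X_n\}}-X_n)$ a.s. $\mathbb{P}_x$, $\mathbb{E}_x$ denote probability and expectation when $X_0=x$. The process is a $[0,1]$-valued martingale, hence converges a.s. to some $X_\infty$. The numbers $\Delta_n$ are defined from the steps by $\Delta_0:=1$ and $\Delta_n:=\gamma_n/\prod_{k=1}^n(1-\gamma_k)$ for $n\ge1$; equivalently $\gamma_n=\Delta_n/S_n$ with $S_n:=\sum_{k=0}^n\Delta_k=1/\prod_{k=1}^n(1-\gamma_k)$. *)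

theory Defs
  imports "HOL-Probability.Probability"
begin

definition bandit_S :: "(nat \<Rightarrow> real) \<Rightarrow> nat \<Rightarrow> real" where
  "bandit_S \<Delta> n = (\<Sum>k=0..n. \<Delta> k)"

(* Only the values at n >= 1 are steps of the algorithm; the value at 0 is never used. *)
definition bandit_step :: "(nat \<Rightarrow> real) \<Rightarrow> nat \<Rightarrow> real" where
  "bandit_step \<Delta> n = \<Delta> n / bandit_S \<Delta> n"

(* The sequence Delta determines the steps gamma and conversely: the next three facts recover
   gamma_n in (0,1), S_n = 1 / prod_{k=1..n} (1 - gamma_k) and
   Delta_n = gamma_n / prod_{k=1..n} (1 - gamma_k) from gamma_n = Delta_n / S_n. *)

lemma bandit_step_bounds:
  assumes "\<Delta> 0 = 1" and pos: "\<And>n. n \<ge> 1 \<Longrightarrow> \<Delta> n > 0" and "n \<ge> 1"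
  shows "0 < bandit_step \<Delta> n" and "bandit_step \<Delta> n < 1"
proof -
  have p: "\<Delta> k > 0" for k
    using assms(1) pos[of k] by (cases k) auto
  obtain j where n: "n = Suc j"
    using \<open>n \<ge> 1\<close> by (cases n) auto
  have "bandit_S \<Delta> j > 0"
    unfolding bandit_S_def by (rule sum_pos) (auto simp: p)
  moreover have "bandit_S \<Delta> n = bandit_S \<Delta> j + \<Delta> n"
    by (simp add: bandit_S_def n)
  ultimately show "0 < bandit_step \<Delta> n" "bandit_step \<Delta> n < 1"
    using p[of n] by (auto simp: bandit_step_def)
qed

lemma bandit_S_eq_inverse_prod:
  assumes "\<Delta> 0 = 1" and pos: "\<And>n. n \<ge> 1 \<Longrightarrow> \<Delta> n > 0"
  shows "bandit_S \<Delta> n = 1 / (\<Prod>k=1..n. 1 - bandit_step \<Delta> k)"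
proof (induction n)
  case 0
  then show ?case by (simp add: bandit_S_def assms)
next
  case (Suc n)
  have p: "\<Delta> k > 0" for k
    using assms(1) pos[of k] by (cases k) auto
  have S: "bandit_S \<Delta> k > 0" for k
    unfolding bandit_S_def by (rule sum_pos) (auto simp: p)
  have "bandit_S \<Delta> (Suc n) = bandit_S \<Delta> n + \<Delta> (Suc n)"
    by (simp add: bandit_S_def)
  then have "1 - bandit_step \<Delta> (Suc n) = bandit_S \<Delta> n / bandit_S \<Delta> (Suc n)"
    using S[of "Suc n"] by (simp add: bandit_step_def field_simps)
  moreover have "(\<Prod>k=1..n. 1 - bandit_step \<Delta> k) = 1 / bandit_S \<Delta> n"
    using Suc S[of n] by (simp add: field_simps)
  ultimately show ?case
    using S[of n] S[of "Suc n"] by simp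
qed

lemma bandit_Delta_eq:
  assumes "\<Delta> 0 = 1" and pos: "\<And>n. n \<ge> 1 \<Longrightarrow> \<Delta> n > 0"
  shows "\<Delta> n = bandit_step \<Delta> n / (\<Prod>k=1..n. 1 - bandit_step \<Delta> k)"
proof -
  have "\<Delta> k > 0" for k
    using assms(1) pos[of k] by (cases k) auto
  then have "bandit_S \<Delta> n > 0"
    unfolding bandit_S_def by (intro sum_pos) auto
  then have "\<Delta> n = bandit_step \<Delta> n * bandit_S \<Delta> n"
    by (simp add: bandit_step_def)
  then show ?thesis
    using bandit_S_eq_inverse_prod[of \<Delta> n] assms by simp
qed

definition iid_uniform :: "'a measure \<Rightarrow> (nat \<Rightarrow> 'a \<Rightarrow> real) \<Rightarrow> bool" where
  "iid_uniform M U \<longleftrightarrow>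
     prob_space.indep_vars M (\<lambda>_. borel) U {1..} \<and>
     (\<forall>n\<ge>1. distr M borel (U n) = uniform_measure lborel {0..1})"

(* The two-armed bandit algorithm with p_A = p_B = 1, steps gamma and innovations U,
   started at x; the initial condition and the recursion are only required almost surely. *)
definition bandit_algorithm ::
  "'a measure \<Rightarrow> (nat \<Rightarrow> real) \<Rightarrow> (nat \<Rightarrow> 'a \<Rightarrow> real) \<Rightarrow> real \<Rightarrow> (nat \<Rightarrow> 'a \<Rightarrow> real) \<Rightarrow> bool" where
  "bandit_algorithm M \<gamma> U x X \<longleftrightarrow>
     (\<forall>n. X n \<in> borel_measurable M) \<and>
     (AE \<omega> in M. X 0 \<omega> = x) \<and>
     (\<forall>n. AE \<omega> in M.
        X (Suc n) \<omega> = X n \<omega> + \<gamma> (Suc n) * (indicator {..X n \<omega>} (U (Suc n) \<omega>) - X n \<omega>))"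

definition beta_density :: "real \<Rightarrow> real \<Rightarrow> real \<Rightarrow> real" where
  "beta_density a b t =
     indicator {0<..<1} t * (t powr (a - 1) * (1 - t) powr (b - 1) / Beta a b)"

end

theory Submission
  imports Defs
begin

text \<open>
  The algorithm is an urn scheme: \<open>S n * X n\<close> is the weight of the colour drawn with probability
  \<open>X n\<close>, and the weight \<open>\<Delta> (n + 1)\<close> is added to the colour of draw \<open>n + 1\<close>. The bound
  \<open>\<Prod>k\<le>m. 1 - (1 - x) / S k\<close> is the probability that the first \<open>m + 1\<close> draws all succeed. Comparing the
  draws \<open>1, \<dots>, m + 1\<close> with the draws \<open>2, \<dots>, m + 2\<close> shows that the probability of \<open>m + 1\<close> consecutive
  successes can only decrease when the run is shifted, because \<open>\<Delta>\<close> is nonincreasing; it is unchanged when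
  \<open>\<Delta>\<close> is constant. Far out in the sequence the steps are negligible, and this probability tends to the
  moment of order \<open>m + 1\<close> of the limit. For constant \<open>\<Delta>\<close> the moments are thus known exactly; they are those
  of the Beta distribution, and moments determine a distribution on the unit interval.
\<close>

subsection \<open>Moments on the unit interval\<close>

text \<open>On the unit interval the absolute moment of order \<open>n\<close> is at most 1, so the
  Taylor remainder of the characteristic function at \<open>t\<close> is at most
  \<open>2 * \<bar>t\<bar> ^ n / fact n\<close>, which tends to 0. The moments therefore determine
  the characteristic function, and Levy's uniqueness theorem applies.\<close>

lemma real_distribution_eqI_moments:
  assumes "real_distribution M1" "real_distribution M2"
    and AE1: "AE t in M1. t \<in> {0..1}" and AE2: "AE t in M2. t \<in> {0..1}"
    and moments: "\<And>n. integral\<^sup>L M1 (\<lambda>t. t ^ n) = integral\<^sup>L M2 (\<lambda>t. t ^ n)"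
  shows "M1 = M2"
proof (rule Levy_uniqueness[OF assms(1,2)], rule ext)
  fix t :: real
  \<comment> \<open>One Taylor polynomial serves both measures, because their moments agree.\<close>
  define P where "P = (\<lambda>n. \<Sum>k\<le>n. ((\<i> * t) ^ k / fact k) * integral\<^sup>L M2 (\<lambda>x. x ^ k))"
  have approx: "cmod (char M t - (\<Sum>k\<le>n. ((\<i> * t) ^ k / fact k) * integral\<^sup>L M (\<lambda>x. x ^ k)))
      \<le> 2 * \<bar>t\<bar> ^ n / fact n"
    if "real_distribution M" and AE: "AE t in M. t \<in> {0..1}" for M and n
  proof -
    interpret real_distribution M by fact
    have int: "integrable M (\<lambda>x. x ^ k)" for k
    proof (rule integrable_const_bound[where B = 1])
      show "AE x in M. norm (x ^ k) \<le> 1"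
        using AE by eventually_elim (simp add: power_le_one)
    qed simp
    have "expectation (\<lambda>x. \<bar>x\<bar> ^ n) \<le> expectation (\<lambda>x. 1)"
    proof (rule integral_mono_AE)
      show "integrable M (\<lambda>x. \<bar>x\<bar> ^ n)"
        using integrable_abs[OF int[of n]] by (simp add: power_abs)
      show "AE x in M. \<bar>x\<bar> ^ n \<le> 1"
        using AE by eventually_elim (simp add: power_le_one)
    qed simp
    then have "expectation (\<lambda>x. \<bar>x\<bar> ^ n) \<le> 1"
      using prob_space by simp
    then have "(2 * \<bar>t\<bar> ^ n / fact n) * expectation (\<lambda>x. \<bar>x\<bar> ^ n) \<le> 2 * \<bar>t\<bar> ^ n / fact n"
      by (intro mult_left_le) auto
    with char_approx1[of n t, OF int] show ?thesis
      by linarith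
  qed
  have "(\<lambda>n. inverse (fact n) * \<bar>t\<bar> ^ n) \<longlonglongrightarrow> 0"
    by (intro summable_LIMSEQ_zero summable_exp)
  from tendsto_mult[OF tendsto_const[of 2] this]
  have lim: "(\<lambda>n. 2 * \<bar>t\<bar> ^ n / fact n) \<longlonglongrightarrow> 0"
    by (simp add: field_simps)
  have "P \<longlonglongrightarrow> char M t" if "\<And>n. cmod (char M t - P n) \<le> 2 * \<bar>t\<bar> ^ n / fact n" for M
    using LIM_zero_cancel[OF Lim_null_comparison[OF _ lim, of "\<lambda>n. P n - char M t"]] that
    by (simp add: norm_minus_commute)
  then have "P \<longlonglongrightarrow> char M1 t" "P \<longlonglongrightarrow> char M2 t"
    using approx[OF assms(1) AE1] approx[OF assms(2) AE2] by (auto simp: P_def moments)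
  then show "char M1 t = char M2 t"
    by (rule LIMSEQ_unique)
qed

section \<open>Moments of the Beta distribution\<close>

lemma Beta_add_nat_left:
  fixes a b :: real
  assumes "0 < a" "0 < b"
  shows "Beta (a + real n) b = Beta a b * (\<Prod>k<n. (a + real k) / (a + b + real k))"
proof (induction n)
  case (Suc n)
  have "(a + real n + b) * Beta (a + real n + 1) b = (a + real n) * Beta (a + real n) b"
    using assms by (intro Beta_plus1_left) (auto elim!: nonpos_Ints_cases)
  then have "Beta (a + real (Suc n)) b = Beta (a + real n) b * ((a + real n) / (a + b + real n))"
    using assms by (simp add: field_simps)
  with Suc show ?case
    by simp
qed simp

text \<open>Multiplying by \<open>t ^ n\<close> shifts the first parameter from \<open>a\<close> to
  \<open>a + n\<close>, so the moment is a quotient of two Beta functions. The integrand is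
  nonnegative, so its nonnegative integral yields integrability and value together.\<close>

lemma beta_density_moment:
  assumes "0 < a" "0 < b"
  shows "has_bochner_integral lborel (\<lambda>t. beta_density a b t * t ^ n)
    (\<Prod>k<n. (a + real k) / (a + b + real k))"
proof -
  have B: "Beta a b > 0"
    using assms by (simp add: Beta_def Gamma_real_pos)
  let ?f = "\<lambda>t. t powr (a + real n - 1) * (1 - t) powr (b - 1)"
  have "(?f has_integral Beta (a + real n) b) {0<..<1}"
    using has_integral_Beta_real[of "a + real n" b] assms by (simp add: has_integral_Icc_iff_Ioo)
  then have "((\<lambda>t. ?f t / Beta a b) has_integral Beta (a + real n) b / Beta a b) {0<..<1}"
    by (rule has_integral_divide)
  then have "(\<integral>\<^sup>+t. ennreal (?f t / Beta a b) * indicator {0<..<1} t \<partial>lborel)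
      = ennreal (Beta (a + real n) b / Beta a b)"
    using B by (intro nn_integral_has_integral_lebesgue') auto
  also have "(\<integral>\<^sup>+t. ennreal (?f t / Beta a b) * indicator {0<..<1} t \<partial>lborel)
      = (\<integral>\<^sup>+t. ennreal (beta_density a b t * t ^ n) \<partial>lborel)"
    by (intro nn_integral_cong)
       (auto simp: beta_density_def indicator_def powr_realpow [symmetric] powr_add diff_add_eq [symmetric] mult_ac)
  also have "Beta (a + real n) b / Beta a b = (\<Prod>k<n. (a + real k) / (a + b + real k))"
    using B by (simp add: Beta_add_nat_left assms)
  finally show ?thesis
    using assms B by (intro has_bochner_integral_nn_integral)
      (auto simp: beta_density_def indicator_def intro!: prod_nonneg)
qed

subsection \<open>Comparison with an independent uniform variable\<close>

text \<open>By independence and Fubini, \<open>Z\<close> can be frozen at \<open>z\<close>; the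
  uniform law then gives the event \<open>V \<le> z\<close> the probability
  \<open>z\<close>.\<close>

lemma (in prob_space) expectation_uniform_le_indep:
  fixes Z V :: "'a \<Rightarrow> real" and g :: "real \<Rightarrow> real"
  assumes indep: "indep_var borel Z borel V"
    and unif: "distr M borel V = uniform_measure lborel {0..1}"
    and Z: "\<And>\<omega>. Z \<omega> \<in> {0..1}"
    and g[measurable]: "g \<in> borel_measurable borel"
    and g_bound: "\<And>z. z \<in> {0..1} \<Longrightarrow> \<bar>g z\<bar> \<le> B"
  shows "expectation (\<lambda>\<omega>. indicator {..Z \<omega>} (V \<omega>) * g (Z \<omega>)) = expectation (\<lambda>\<omega>. Z \<omega> * g (Z \<omega>))"
proof -
  have [measurable]: "Z \<in> borel_measurable M" "V \<in> borel_measurable M"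
    using indep by (auto simp: indep_var_distribution_eq)
  let ?Z = "distr M borel Z" and ?V = "distr M borel V"
  interpret PZ: prob_space ?Z by (rule prob_space_distr) simp
  interpret PV: prob_space ?V by (rule prob_space_distr) simp
  interpret P: pair_prob_space ?Z ?V ..
  \<comment> \<open>The indicator becomes a conditional, for which joint measurability in
    \<open>(z, v)\<close> is immediate.\<close>
  define f :: "real \<times> real \<Rightarrow> real" where "f = (\<lambda>(z, v). (if v \<le> z then 1 else 0) * g z)"
  have [measurable]: "f \<in> borel_measurable (borel \<Otimes>\<^sub>M borel)"
    unfolding f_def by measurable
  have pair: "?Z \<Otimes>\<^sub>M ?V = distr M (borel \<Otimes>\<^sub>M borel) (\<lambda>\<omega>. (Z \<omega>, V \<omega>))"
    using indep by (simp add: indep_var_distribution_eq)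
  have "B \<ge> 0"
    using g_bound[of 0] by simp
  then have "integrable M (\<lambda>\<omega>. f (Z \<omega>, V \<omega>))"
    by (intro integrable_const_bound[where B = B]) (use g_bound Z in \<open>auto simp: f_def\<close>)
  then have int: "integrable (?Z \<Otimes>\<^sub>M ?V) f"
    unfolding pair by (subst integrable_distr_eq) auto
  have "AE z in ?Z. z \<in> {0..1}"
    by (subst AE_distr_iff) (use Z in auto)
  then have inner: "AE z in ?Z. (\<integral>v. f (z, v) \<partial>?V) = z * g z"
  proof eventually_elim
    case (elim z)
    have "measure ?V {..z} = measure (uniform_measure lborel {0..1::real}) {..z}"
      by (simp only: unif)
    also have "\<dots> = measure lborel ({0..1} \<inter> {..z}) / measure lborel {0..1::real}"
      by (rule measure_uniform_measure) auto
    also have "{0..1} \<inter> {..z} = {0..z}"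
      using elim by auto
    finally have "measure ?V {..z} = z"
      using elim by simp
    moreover have "(\<integral>v. f (z, v) \<partial>?V) = (\<integral>v. indicator {..z} v * g z \<partial>?V)"
      by (intro Bochner_Integration.integral_cong) (auto simp: f_def indicator_def)
    ultimately show ?case
      by simp
  qed
  have "expectation (\<lambda>\<omega>. indicator {..Z \<omega>} (V \<omega>) * g (Z \<omega>)) = expectation (\<lambda>\<omega>. f (Z \<omega>, V \<omega>))"
    by (intro Bochner_Integration.integral_cong) (auto simp: f_def indicator_def)
  also have "\<dots> = integral\<^sup>L (?Z \<Otimes>\<^sub>M ?V) f"
    unfolding pair by (subst integral_distr) auto
  also have "\<dots> = (\<integral>z. (\<integral>v. f (z, v) \<partial>?V) \<partial>?Z)"
    by (rule P.integral_fst'[symmetric, OF int])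
  also have "\<dots> = (\<integral>z. z * g z \<partial>?Z)"
    by (rule integral_cong_AE) (use inner in \<open>simp_all add: f_def\<close>)
  also have "\<dots> = expectation (\<lambda>\<omega>. Z \<omega> * g (Z \<omega>))"
    by (rule integral_distr) auto
  finally show ?thesis .
qed

subsection \<open>Runs of successes\<close>

text \<open>
  The conditional probability of the event that \<open>U (n + k + 1) \<le> X (n + k)\<close> for
  all \<open>k \<le> m\<close>, given \<open>X n = z\<close>.
\<close>

definition run_prob :: "(nat \<Rightarrow> real) \<Rightarrow> nat \<Rightarrow> nat \<Rightarrow> real \<Rightarrow> real" where
  "run_prob D m n z = (\<Prod>k=0..m. 1 - (1 - z) * bandit_S D n / bandit_S D (n + k))"

lemma run_prob_measurable [measurable]: "run_prob D m n \<in> borel_measurable borel"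
  unfolding run_prob_def by measurable

locale bandit_weights =
  fixes D :: "nat \<Rightarrow> real"
  assumes D_0: "D 0 = 1" and D_pos: "\<And>n. n \<ge> 1 \<Longrightarrow> D n > 0"
begin

lemma S_0: "bandit_S D 0 = 1"
  by (simp add: bandit_S_def D_0)

lemma S_Suc: "bandit_S D (Suc n) = bandit_S D n + D (Suc n)"
  by (simp add: bandit_S_def)

lemma S_mono: "m \<le> n \<Longrightarrow> bandit_S D m \<le> bandit_S D n"
  by (rule lift_Suc_mono_le[of "bandit_S D"]) (use D_pos in \<open>auto simp: S_Suc intro: less_imp_le\<close>)

lemma S_ge_1: "bandit_S D n \<ge> 1"
  using S_mono[of 0 n] by (simp add: S_0)

lemma S_pos: "bandit_S D n > 0"
  using S_ge_1[of n] by linarith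

lemma step_bounds: "bandit_step D (Suc n) \<in> {0<..<1}"
  using bandit_step_bounds[of D "Suc n"] D_0 D_pos by auto

lemma step_up: "z \<in> {0..1} \<Longrightarrow> z + bandit_step D (Suc n) * (1 - z) \<in> {0..1}"
  using step_bounds[of n] mult_right_mono[of "bandit_step D (Suc n)" 1 "1 - z"] by auto

lemma step_down: "z \<in> {0..1} \<Longrightarrow> z - bandit_step D (Suc n) * z \<in> {0..1}"
proof -
  assume z: "z \<in> {0..1}"
  with step_bounds[of n] have "bandit_step D (Suc n) * z \<le> 1 * z"
    by (intro mult_right_mono) auto
  moreover have "bandit_step D (Suc n) * z \<ge> 0"
    using step_bounds[of n] z by auto
  ultimately show ?thesis using z by auto
qed

lemma run_factor_bounds:
  assumes "z \<in> {0..1}"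
  shows "1 - (1 - z) * bandit_S D n / bandit_S D (n + k) \<in> {0..1}"
proof -
  have "(1 - z) * bandit_S D n \<le> 1 * bandit_S D (n + k)"
    using assms S_mono[of n "n + k"] S_pos[of n] by (intro mult_mono) auto
  then show ?thesis
    using assms S_pos[of n] S_pos[of "n + k"] by auto
qed

lemma run_prob_bounds: "z \<in> {0..1} \<Longrightarrow> run_prob D m n z \<in> {0..1}"
  using run_factor_bounds unfolding run_prob_def by (auto intro!: prod_nonneg prod_le_1)

text \<open>A success leaves the failure weight \<open>(1 - z) * bandit_S D n\<close> unchanged, so
  only the total weights in the denominators move on by one index.\<close>

lemma run_prob_up:
  "run_prob D m (Suc n) (z + bandit_step D (Suc n) * (1 - z))
     = (\<Prod>k=0..m. 1 - (1 - z) * bandit_S D n / bandit_S D (n + Suc k))"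
  unfolding run_prob_def
proof (rule prod.cong[OF refl])
  fix k
  have "(1 - (z + bandit_step D (Suc n) * (1 - z))) * bandit_S D (Suc n) = (1 - z) * bandit_S D n"
    using S_pos[of "Suc n"] by (simp add: bandit_step_def field_simps) (simp add: S_Suc algebra_simps)
  then show "1 - (1 - (z + bandit_step D (Suc n) * (1 - z))) * bandit_S D (Suc n) / bandit_S D (Suc n + k)
      = 1 - (1 - z) * bandit_S D n / bandit_S D (n + Suc k)"
    by simp
qed

text \<open>A failure raises the failure weight to
  \<open>(1 - z) * bandit_S D n + D (Suc n)\<close>. Each factor is what remains of the total
  weight, divided by that total.\<close>

lemma run_prob_down:
  "run_prob D m (Suc n) (z - bandit_step D (Suc n) * z)
     = (\<Prod>k=0..m. (bandit_S D (n + Suc k) - D (Suc n) - (1 - z) * bandit_S D n) / bandit_S D (n + Suc k))"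
  unfolding run_prob_def
proof (rule prod.cong[OF refl])
  fix k
  have "(1 - (z - bandit_step D (Suc n) * z)) * bandit_S D (Suc n) = (1 - z) * bandit_S D n + D (Suc n)"
    using S_pos[of "Suc n"] by (simp add: bandit_step_def field_simps) (simp add: S_Suc algebra_simps)
  then show "1 - (1 - (z - bandit_step D (Suc n) * z)) * bandit_S D (Suc n) / bandit_S D (Suc n + k)
      = (bandit_S D (n + Suc k) - D (Suc n) - (1 - z) * bandit_S D n) / bandit_S D (n + Suc k)"
    using S_pos[of "n + Suc k"] by (simp add: field_simps)
qed

text \<open>Let \<open>c k\<close> be the factors of \<open>run_prob\<close>. Since
  \<open>c 0 = z\<close>, the first summand is \<open>run_prob D m n z * c (Suc m)\<close>. In the
  second, the quotients of consecutive totals telescope, leaving \<open>run_prob D m n z\<close>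
  times \<open>(1 - z) * bandit_S D n / bandit_S D (n + Suc m)\<close>, that is, times
  \<open>1 - c (Suc m)\<close>.\<close>

lemma run_prob_telescope:
  "z * (\<Prod>k=0..m. 1 - (1 - z) * bandit_S D n / bandit_S D (n + Suc k))
   + (1 - z) * (\<Prod>k=0..m. (bandit_S D (n + k) - (1 - z) * bandit_S D n) / bandit_S D (n + Suc k))
   = run_prob D m n z"
proof -
  let ?c = "\<lambda>k. 1 - (1 - z) * bandit_S D n / bandit_S D (n + k)"
  have c0: "?c 0 = z"
    using S_pos[of n] by simp
  have up: "z * (\<Prod>k=0..m. ?c (Suc k)) = run_prob D m n z * ?c (Suc m)"
    using prod.atLeast0_atMost_Suc_shift[of ?c m] prod.atLeast0_atMost_Suc[of ?c m] c0
    by (simp add: run_prob_def comp_def)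
  have "(\<Prod>k=0..m. bandit_S D (n + k) / bandit_S D (n + Suc k)) = bandit_S D n / bandit_S D (n + Suc m)"
    using S_pos by (induction m) (auto simp: less_imp_neq[THEN not_sym])
  moreover have "(bandit_S D (n + k) - (1 - z) * bandit_S D n) / bandit_S D (n + Suc k)
      = ?c k * (bandit_S D (n + k) / bandit_S D (n + Suc k))" for k
    using S_pos[of "n + k"] S_pos[of "n + Suc k"] by (simp add: field_simps)
  ultimately have down: "(\<Prod>k=0..m. (bandit_S D (n + k) - (1 - z) * bandit_S D n) / bandit_S D (n + Suc k))
      = run_prob D m n z * (bandit_S D n / bandit_S D (n + Suc m))"
    by (simp only: prod.distrib run_prob_def)
  show ?thesis
    unfolding up down by (simp add: algebra_simps)
qed

text \<open>The left side minus the right side is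
  \<open>D (Suc (n + k)) - D (Suc n)\<close>.\<close>

lemma S_diff_le:
  assumes "antimono_on {1..} D"
  shows "bandit_S D (n + Suc k) - D (Suc n) \<le> bandit_S D (n + k)"
  using monotone_onD[OF assms, of "Suc n" "Suc (n + k)"] by (simp add: S_Suc)

text \<open>
  After a first failure, the \<open>k\<close>-th draw of the run starting one step later finds the success weight
  \<open>bandit_S D (n + Suc k) - D (Suc n) - (1 - z) * bandit_S D n\<close>. As \<open>D\<close> is nonincreasing, this is at
  most the weight \<open>bandit_S D (n + k) - (1 - z) * bandit_S D n\<close> found by the \<open>k\<close>-th draw of the run
  starting now.
\<close>

lemma run_prob_step_le:
  assumes "antimono_on {1..} D" and z: "z \<in> {0..1}"
  shows "z * run_prob D m (Suc n) (z + bandit_step D (Suc n) * (1 - z))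
      + (1 - z) * run_prob D m (Suc n) (z - bandit_step D (Suc n) * z) \<le> run_prob D m n z"
proof -
  \<comment> \<open>Comparing products factor by factor requires the smaller factors to be
    nonnegative. They are, because the total \<open>bandit_S D (n + Suc k)\<close> already contains
    \<open>bandit_S D n\<close> and \<open>D (Suc n)\<close>.\<close>
  have "(bandit_S D (n + Suc k) - D (Suc n) - (1 - z) * bandit_S D n) / bandit_S D (n + Suc k) \<ge> 0" for k
  proof -
    have "(1 - z) * bandit_S D n \<le> bandit_S D n"
      using z S_pos[of n] by (simp add: mult_le_cancel_right1)
    moreover have "bandit_S D n + D (Suc n) \<le> bandit_S D (n + Suc k)"
      using S_mono[of "Suc n" "n + Suc k"] by (simp add: S_Suc)
    ultimately show ?thesis
      using S_pos[of "n + Suc k"] by simp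
  qed
  then have "run_prob D m (Suc n) (z - bandit_step D (Suc n) * z)
      \<le> (\<Prod>k=0..m. (bandit_S D (n + k) - (1 - z) * bandit_S D n) / bandit_S D (n + Suc k))"
    unfolding run_prob_down
    by (intro prod_mono conjI divide_right_mono)
       (use S_diff_le[OF assms(1)] S_pos in \<open>auto intro: less_imp_le\<close>)
  then have "(1 - z) * run_prob D m (Suc n) (z - bandit_step D (Suc n) * z)
      \<le> (1 - z) * (\<Prod>k=0..m. (bandit_S D (n + k) - (1 - z) * bandit_S D n) / bandit_S D (n + Suc k))"
    using z by (intro mult_left_mono) auto
  with run_prob_telescope[of z n m] show ?thesis
    unfolding run_prob_up by linarith
qed

text \<open>For constant weights the comparison in \<open>S_diff_le\<close> is an equality, so the
  product after a failure is exactly the one in \<open>run_prob_telescope\<close>.\<close>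

lemma run_prob_step_eq:
  assumes "\<And>k. k \<ge> 1 \<Longrightarrow> D k = \<delta>"
  shows "z * run_prob D m (Suc n) (z + bandit_step D (Suc n) * (1 - z))
      + (1 - z) * run_prob D m (Suc n) (z - bandit_step D (Suc n) * z) = run_prob D m n z"
proof -
  have "bandit_S D (n + Suc k) - D (Suc n) = bandit_S D (n + k)" for k
    using assms[of "Suc n"] assms[of "Suc (n + k)"] by (simp add: S_Suc)
  then show ?thesis
    unfolding run_prob_up run_prob_down by (simp only: run_prob_telescope)
qed

lemma run_prob_0: "run_prob D m 0 z = (\<Prod>k=0..m. 1 - (1 - z) / bandit_S D k)"
  by (simp add: run_prob_def S_0)

end

section \<open>Asymptotics of the weights\<close>

locale diverging_bandit_weights = bandit_weights +
  assumes step_sum: "filterlim (\<lambda>n. \<Sum>k=1..n. bandit_step D k) at_top sequentially"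
    and antimono: "antimono_on {1..} D"
begin

lemma D_le: "n \<ge> 1 \<Longrightarrow> D n \<le> D 1"
  using monotone_onD[OF antimono, of 1 n] by simp

text \<open>As \<open>bandit_S D k \<ge> 1\<close>, each step is at most the corresponding weight,
  so the totals dominate the divergent sum of the steps.\<close>

lemma S_at_top: "filterlim (bandit_S D) at_top sequentially"
proof (rule filterlim_at_top_mono[OF step_sum], rule always_eventually, rule allI)
  fix n
  have "bandit_step D k \<le> D k" if "k \<in> {1..n}" for k
    using S_ge_1[of k] D_pos[of k] that by (simp add: bandit_step_def divide_le_eq mult_le_cancel_left1)
  then have "(\<Sum>k=1..n. bandit_step D k) \<le> (\<Sum>k=1..n. D k)"
    by (rule sum_mono)
  also have "\<dots> \<le> bandit_S D n"
    by (simp add: bandit_S_def sum.atLeast_Suc_atMost[of 0] D_0)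
  finally show "(\<Sum>k=1..n. bandit_step D k) \<le> bandit_S D n" .
qed

text \<open>The \<open>k\<close> weights added after index \<open>n\<close> are each at most
  \<open>D 1\<close>, a bounded increment against a total tending to infinity.\<close>

lemma S_ratio_tendsto: "(\<lambda>n. bandit_S D n / bandit_S D (n + k)) \<longlonglongrightarrow> 1"
proof -
  have diff: "bandit_S D (n + k) - bandit_S D n \<le> real k * D 1" for n
  proof (induction k)
    case (Suc k)
    then show ?case using D_le[of "Suc (n + k)"] by (simp add: S_Suc algebra_simps)
  qed simp
  have lim: "(\<lambda>n. 1 - real k * D 1 / bandit_S D n) \<longlonglongrightarrow> 1"
  proof -
    have "(\<lambda>n. 1 - real k * D 1 / bandit_S D n) \<longlonglongrightarrow> 1 - 0"
      by (intro tendsto_diff tendsto_const real_tendsto_divide_at_top[OF tendsto_const] S_at_top)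
    then show ?thesis
      unfolding diff_zero .
  qed
  have lower: "1 - real k * D 1 / bandit_S D n \<le> bandit_S D n / bandit_S D (n + k)" for n
  proof -
    have "1 - bandit_S D n / bandit_S D (n + k) = (bandit_S D (n + k) - bandit_S D n) / bandit_S D (n + k)"
      using S_pos[of "n + k"] by (simp add: field_simps)
    also have "\<dots> \<le> real k * D 1 / bandit_S D n"
      using diff[of n] S_pos[of n] S_mono[of n "n + k"] D_pos[of 1] by (intro frac_le) auto
    finally show ?thesis by linarith
  qed
  have upper: "bandit_S D n / bandit_S D (n + k) \<le> 1" for n
    using S_pos[of "n + k"] S_mono[of n "n + k"] by simp
  show ?thesis
    by (rule tendsto_sandwich[OF always_eventually always_eventually lim tendsto_const])
       (intro allI lower upper)+
qed

lemma run_prob_tendsto: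
  assumes "z \<longlonglongrightarrow> l"
  shows "(\<lambda>n. run_prob D m n (z n)) \<longlonglongrightarrow> l ^ (m + 1)"
proof -
  have "(\<lambda>n. \<Prod>k=0..m. 1 - (1 - z n) * (bandit_S D n / bandit_S D (n + k)))
      \<longlonglongrightarrow> (\<Prod>k=0..m. 1 - (1 - l) * 1)"
    by (intro tendsto_prod tendsto_diff tendsto_mult tendsto_const assms S_ratio_tendsto)
  then show ?thesis
    by (simp add: run_prob_def)
qed

text \<open>From \<open>D k \<le> D 1\<close> follows
  \<open>1 / bandit_S D k \<ge> bandit_step D k / D 1\<close>. With
  \<open>1 - u \<le> exp (- u)\<close>, the product is bounded by the exponential of a negative
  multiple of the divergent sum of the steps.\<close>

lemma prod_S_tendsto_0:
  assumes "0 < c" "c \<le> 1"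
  shows "(\<lambda>m. \<Prod>k=0..m. 1 - c / bandit_S D k) \<longlonglongrightarrow> 0"
proof (rule tendsto_sandwich)
  have factor: "0 \<le> 1 - c / bandit_S D k" for k
    using S_ge_1[of k] assms by simp
  show "\<forall>\<^sub>F m in sequentially. 0 \<le> (\<Prod>k=0..m. 1 - c / bandit_S D k)"
    using factor by (auto intro!: always_eventually prod_nonneg)
  have D1: "D 1 > 0" by (simp add: D_pos)
  have "(\<Prod>k=0..m. 1 - c / bandit_S D k) \<le> exp (- (c / D 1 * (\<Sum>k=1..m. bandit_step D k)))" for m
  proof -
    \<comment> \<open>The factor at 0 is split off because \<open>D 0 = 1\<close> may exceed
      \<open>D 1\<close> and the sum of the steps starts at 1.\<close>
    have "(\<Prod>k=0..m. 1 - c / bandit_S D k) = (1 - c / bandit_S D 0) * (\<Prod>k=1..m. 1 - c / bandit_S D k)"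
      by (simp add: prod.atLeast_Suc_atMost)
    also have "\<dots> \<le> 1 * (\<Prod>k=1..m. exp (- (c / D 1 * bandit_step D k)))"
    proof (intro mult_mono prod_mono conjI factor prod_nonneg ballI)
      show "1 - c / bandit_S D 0 \<le> 1"
        using assms S_pos[of 0] by simp
      fix k assume "k \<in> {1..m}"
      then have "c / D 1 * bandit_step D k \<le> c / bandit_S D k"
        using D1 S_pos[of k] D_le[of k] assms by (simp add: bandit_step_def field_simps)
      then show "1 - c / bandit_S D k \<le> exp (- (c / D 1 * bandit_step D k))"
        using exp_ge_add_one_self[of "- (c / D 1 * bandit_step D k)"] by linarith
    qed auto
    also have "\<dots> = exp (- (c / D 1 * (\<Sum>k=1..m. bandit_step D k)))"
      by (simp add: exp_sum [symmetric] sum_negf sum_distrib_left)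
    finally show ?thesis .
  qed
  then show "\<forall>\<^sub>F m in sequentially. (\<Prod>k=0..m. 1 - c / bandit_S D k)
      \<le> exp (- (c / D 1 * (\<Sum>k=1..m. bandit_step D k)))"
    by simp
  have "filterlim (\<lambda>m. c / D 1 * (\<Sum>k=1..m. bandit_step D k)) at_top sequentially"
    using assms D1 by (intro filterlim_tendsto_pos_mult_at_top[OF tendsto_const _ step_sum]) simp
  then show "(\<lambda>m. exp (- (c / D 1 * (\<Sum>k=1..m. bandit_step D k)))) \<longlonglongrightarrow> 0"
    by (intro filterlim_compose[OF exp_at_bot] filterlim_compose[OF filterlim_uminus_at_bot_at_top])
qed simp

end

subsection \<open>Moments of the limit\<close>

text \<open>
  Both \<open>X\<close> and \<open>1 - X\<close> satisfy this one-step relation, which is all that the moment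
  bounds use.
\<close>

locale urn_process = prob_space M + diverging_bandit_weights D
  for M :: "'a measure" and D :: "nat \<Rightarrow> real" +
  fixes Y :: "nat \<Rightarrow> 'a \<Rightarrow> real" and y :: real and Yinf :: "'a \<Rightarrow> real"
  assumes Y_measurable [measurable]: "\<And>n. Y n \<in> borel_measurable M"
    and Y_bounds: "\<And>n \<omega>. Y n \<omega> \<in> {0..1}"
    and Y_0: "\<And>\<omega>. Y 0 \<omega> = y"
    and Y_step: "\<And>n h B. h \<in> borel_measurable borel \<Longrightarrow> (\<And>z. z \<in> {0..1} \<Longrightarrow> \<bar>h z\<bar> \<le> B) \<Longrightarrow>
      expectation (\<lambda>\<omega>. h (Y (Suc n) \<omega>)) =
      expectation (\<lambda>\<omega>. Y n \<omega> * h (Y n \<omega> + bandit_step D (Suc n) * (1 - Y n \<omega>))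
        + (1 - Y n \<omega>) * h (Y n \<omega> - bandit_step D (Suc n) * Y n \<omega>))"
    and Yinf_measurable [measurable]: "Yinf \<in> borel_measurable M"
    and Y_tendsto: "AE \<omega> in M. (\<lambda>n. Y n \<omega>) \<longlonglongrightarrow> Yinf \<omega>"
begin

lemma Yinf_bounds: "AE \<omega> in M. Yinf \<omega> \<in> {0..1}"
  using Y_tendsto
proof eventually_elim
  case (elim \<omega>)
  then show ?case
    by (rule closed_sequentially[OF closed_atLeastAtMost Y_bounds])
qed

lemma integrable_Yinf_power: "integrable M (\<lambda>\<omega>. Yinf \<omega> ^ m)"
proof (rule integrable_const_bound[where B = 1])
  show "AE \<omega> in M. norm (Yinf \<omega> ^ m) \<le> 1"
    using Yinf_bounds by eventually_elim (simp add: power_le_one)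
qed simp

lemma expectation_Yinf_power_nonneg: "0 \<le> expectation (\<lambda>\<omega>. Yinf \<omega> ^ m)"
proof (rule integral_nonneg_AE)
  show "AE \<omega> in M. 0 \<le> Yinf \<omega> ^ m"
    using Yinf_bounds by eventually_elim simp
qed

lemma run_prob_Y_bounds: "run_prob D m n (Y n' \<omega>) \<in> {0..1}"
  by (intro run_prob_bounds Y_bounds)

lemma run_prob_Suc_expectation:
  "expectation (\<lambda>\<omega>. run_prob D m (Suc n) (Y (Suc n) \<omega>)) =
   expectation (\<lambda>\<omega>. Y n \<omega> * run_prob D m (Suc n) (Y n \<omega> + bandit_step D (Suc n) * (1 - Y n \<omega>))
     + (1 - Y n \<omega>) * run_prob D m (Suc n) (Y n \<omega> - bandit_step D (Suc n) * Y n \<omega>))"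
proof (rule Y_step[OF run_prob_measurable])
  show "\<bar>run_prob D m (Suc n) z\<bar> \<le> 1" if "z \<in> {0..1}" for z
    using run_prob_bounds[OF that, of m "Suc n"] by simp
qed

text \<open>The one-step relation turns the expectation at \<open>Suc n\<close> into that of the
  weighted average in \<open>run_prob_step_le\<close>, so the expectations are nonincreasing in
  \<open>n\<close>, as for a supermartingale.\<close>

lemma run_prob_expectation_le:
  "expectation (\<lambda>\<omega>. run_prob D m n (Y n \<omega>)) \<le> run_prob D m 0 y"
proof (induction n)
  case 0
  show ?case by (simp add: Y_0 prob_space)
next
  case (Suc n)
  have "expectation (\<lambda>\<omega>. run_prob D m (Suc n) (Y (Suc n) \<omega>))
      \<le> expectation (\<lambda>\<omega>. run_prob D m n (Y n \<omega>))"
    unfolding run_prob_Suc_expectation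
  proof (rule integral_mono)
    show int: "integrable M (\<lambda>\<omega>. run_prob D m n (Y n \<omega>))"
      by (rule integrable_const_bound[where B = 1]) (use run_prob_Y_bounds[of m n n] in simp_all)
    show le: "Y n \<omega> * run_prob D m (Suc n) (Y n \<omega> + bandit_step D (Suc n) * (1 - Y n \<omega>))
        + (1 - Y n \<omega>) * run_prob D m (Suc n) (Y n \<omega> - bandit_step D (Suc n) * Y n \<omega>)
        \<le> run_prob D m n (Y n \<omega>)" for \<omega>
      by (rule run_prob_step_le[OF antimono Y_bounds])
    \<comment> \<open>Together with \<open>le\<close> this places the average between 0 and an
      integrable function, which makes it integrable.\<close>
    have nonneg: "0 \<le> Y n \<omega> * run_prob D m (Suc n) (Y n \<omega> + bandit_step D (Suc n) * (1 - Y n \<omega>))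
        + (1 - Y n \<omega>) * run_prob D m (Suc n) (Y n \<omega> - bandit_step D (Suc n) * Y n \<omega>)" for \<omega>
      using Y_bounds[of n \<omega>] run_prob_bounds[OF step_up[OF Y_bounds[of n \<omega>], of n], of m "Suc n"]
        run_prob_bounds[OF step_down[OF Y_bounds[of n \<omega>], of n], of m "Suc n"]
      by (intro add_nonneg_nonneg mult_nonneg_nonneg) simp_all
    show "integrable M (\<lambda>\<omega>. Y n \<omega> * run_prob D m (Suc n) (Y n \<omega> + bandit_step D (Suc n) * (1 - Y n \<omega>))
        + (1 - Y n \<omega>) * run_prob D m (Suc n) (Y n \<omega> - bandit_step D (Suc n) * Y n \<omega>))"
      by (rule Bochner_Integration.integrable_bound[OF int])
         (use nonneg le order_trans[OF nonneg le] in \<open>simp_all only: real_norm_def abs_of_nonneg AE_I2\<close>, measurable)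
  qed
  with Suc show ?case by linarith
qed

lemma run_prob_expectation_const:
  assumes "\<And>k. k \<ge> 1 \<Longrightarrow> D k = \<delta>"
  shows "expectation (\<lambda>\<omega>. run_prob D m n (Y n \<omega>)) = run_prob D m 0 y"
proof (induction n)
  case 0
  show ?case by (simp add: Y_0 prob_space)
next
  case (Suc n)
  then show ?case
    by (simp only: run_prob_Suc_expectation run_prob_step_eq[OF assms])
qed

text \<open>The run probabilities are bounded by 1 and converge almost surely by
  \<open>run_prob_tendsto\<close>, so dominated convergence applies.\<close>

lemma run_prob_expectation_tendsto:
  "(\<lambda>n. expectation (\<lambda>\<omega>. run_prob D m n (Y n \<omega>))) \<longlonglongrightarrow> expectation (\<lambda>\<omega>. Yinf \<omega> ^ (m + 1))"
proof (rule integral_dominated_convergence[where w = "\<lambda>_. 1"])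
  show "AE \<omega> in M. (\<lambda>n. run_prob D m n (Y n \<omega>)) \<longlonglongrightarrow> Yinf \<omega> ^ (m + 1)"
    using Y_tendsto by eventually_elim (rule run_prob_tendsto)
  show "AE \<omega> in M. norm (run_prob D m n (Y n \<omega>)) \<le> 1" for n
    using run_prob_Y_bounds[of m n n] by simp
qed simp_all

lemma moment_le: "expectation (\<lambda>\<omega>. Yinf \<omega> ^ (m + 1)) \<le> (\<Prod>k=0..m. 1 - (1 - y) / bandit_S D k)"
  using run_prob_expectation_le
  by (intro LIMSEQ_le_const2[OF run_prob_expectation_tendsto]) (auto simp flip: run_prob_0)

lemma moment_eq:
  assumes "\<And>k. k \<ge> 1 \<Longrightarrow> D k = \<delta>"
  shows "expectation (\<lambda>\<omega>. Yinf \<omega> ^ (m + 1)) = (\<Prod>k=0..m. 1 - (1 - y) / bandit_S D k)"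
  using run_prob_expectation_tendsto[of m]
  by (simp only: run_prob_expectation_const[OF assms] run_prob_0 LIMSEQ_const_iff)

lemma bdd_below_moments: "bdd_below (range (\<lambda>m. expectation (\<lambda>\<omega>. Yinf \<omega> ^ m)))"
  using expectation_Yinf_power_nonneg by (auto intro!: bdd_belowI)

text \<open>Every power of \<open>Yinf\<close> is 1 where \<open>Yinf\<close> is 1 and nonnegative
  almost surely, so it dominates the indicator of that event.\<close>

lemma prob_limit_eq_1_le: "prob {\<omega> \<in> space M. Yinf \<omega> = 1} \<le> (INF m. expectation (\<lambda>\<omega>. Yinf \<omega> ^ m))"
proof (rule cINF_greatest)
  fix m
  have "prob {\<omega> \<in> space M. Yinf \<omega> = 1} = expectation (indicator {\<omega> \<in> space M. Yinf \<omega> = 1})"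
    by simp
  also have "\<dots> \<le> expectation (\<lambda>\<omega>. Yinf \<omega> ^ m)"
  proof (rule integral_mono_AE[OF _ integrable_Yinf_power])
    show "AE \<omega> in M. indicator {\<omega> \<in> space M. Yinf \<omega> = 1} \<omega> \<le> Yinf \<omega> ^ m"
      using Yinf_bounds by eventually_elim (auto simp: indicator_def)
  qed (auto simp: emeasure_eq_measure)
  finally show "prob {\<omega> \<in> space M. Yinf \<omega> = 1} \<le> expectation (\<lambda>\<omega>. Yinf \<omega> ^ m)" .
qed simp

lemma INF_moments_eq_0:
  assumes "0 \<le> y" "y < 1"
  shows "(INF m. expectation (\<lambda>\<omega>. Yinf \<omega> ^ m)) = 0"
proof (rule antisym)
  have "(INF m. expectation (\<lambda>\<omega>. Yinf \<omega> ^ m)) \<le> (\<Prod>k=0..m. 1 - (1 - y) / bandit_S D k)" for m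
    by (rule order_trans[OF cINF_lower[OF bdd_below_moments] moment_le]) simp
  then show "(INF m. expectation (\<lambda>\<omega>. Yinf \<omega> ^ m)) \<le> 0"
    using assms by (intro LIMSEQ_le_const[OF prod_S_tendsto_0[of "1 - y"]]) auto
  show "0 \<le> (INF m. expectation (\<lambda>\<omega>. Yinf \<omega> ^ m))"
    by (rule cINF_greatest) (auto intro: expectation_Yinf_power_nonneg)
qed

text \<open>With \<open>a = y / \<delta>\<close> and \<open>b = (1 - y) / \<delta>\<close> one has
  \<open>a + b = 1 / \<delta>\<close> and \<open>bandit_S D k = 1 + k * \<delta>\<close>. Dividing
  by \<open>\<delta>\<close> turns the factors in \<open>moment_eq\<close> into those of the Beta
  moments, and equal moments on the unit interval give equal laws.\<close>

lemma limit_beta_distributed: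
  assumes const: "\<And>k. k \<ge> 1 \<Longrightarrow> D k = \<delta>" and y: "0 < y" "y < 1"
  shows "distributed M lborel Yinf (\<lambda>t. ennreal (beta_density (y / \<delta>) ((1 - y) / \<delta>) t))"
proof -
  have \<delta>: "\<delta> > 0"
    using D_pos[of 1] const[of 1] by simp
  define a b where "a = y / \<delta>" and "b = (1 - y) / \<delta>"
  have ab: "a > 0" "b > 0"
    using y \<delta> by (auto simp: a_def b_def)
  have nonneg: "beta_density a b t \<ge> 0" for t
    using ab by (auto simp: beta_density_def indicator_def Beta_def Gamma_real_pos)
  have [measurable]: "beta_density a b \<in> borel_measurable borel"
    unfolding beta_density_def by measurable
  let ?L = "distr M borel Yinf" and ?R = "density lborel (\<lambda>t. ennreal (beta_density a b t))"
  have S: "bandit_S D k = 1 + real k * \<delta>" for k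
    by (induction k) (simp_all add: S_0 S_Suc const algebra_simps)
  have factor: "1 - (1 - y) / bandit_S D k = (a + real k) / (a + b + real k)" for k
  proof -
    have "a + b + real k = bandit_S D k / \<delta>" "a + real k = (bandit_S D k - (1 - y)) / \<delta>"
      using \<delta> by (simp_all add: a_def b_def S field_simps)
    then show ?thesis
      using \<delta> S_pos[of k] by (simp add: diff_divide_distrib[of _ _ "bandit_S D k"])
  qed
  interpret L: real_distribution ?L
    by (simp add: real_distribution_distr)
  have "real_distribution ?R"
  proof (intro real_distribution.intro prob_spaceI real_distribution_axioms.intro)
    \<comment> \<open>The moment of order 0 is an empty product, so the density has total mass
      1.\<close>
    have "(\<integral>\<^sup>+t. ennreal (beta_density a b t) \<partial>lborel) = 1"
      using beta_density_moment[OF ab, of 0] nonneg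
      by (simp add: has_bochner_integral_iff nn_integral_eq_integral)
    then show "emeasure ?R (space ?R) = 1"
      by (simp add: emeasure_density)
  qed simp
  have "?L = ?R"
  proof (rule real_distribution_eqI_moments)
    show "AE t in ?L. t \<in> {0..1}"
      using Yinf_bounds by (subst AE_distr_iff) auto
    show "AE t in ?R. t \<in> {0..1}"
      by (subst AE_density) (auto simp: beta_density_def indicator_def)
    fix n
    have "integral\<^sup>L ?L (\<lambda>t. t ^ n) = expectation (\<lambda>\<omega>. Yinf \<omega> ^ n)"
      by (rule integral_distr) auto
    also have "\<dots> = (\<Prod>k<n. (a + real k) / (a + b + real k))"
    \<comment> \<open>\<open>moment_eq\<close> gives the positive orders, the moment of order
      \<open>Suc m\<close> being a product over \<open>{0..m}\<close>; order 0 is the total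
      mass.\<close>
    proof (cases n)
      case (Suc m)
      have "{0..m} = {..<n}"
        using Suc by auto
      with moment_eq[OF const, of m] show ?thesis
        by (simp add: Suc factor)
    qed (simp add: prob_space)
    also have "\<dots> = integral\<^sup>L ?R (\<lambda>t. t ^ n)"
      using beta_density_moment[OF ab, of n] nonneg
      by (subst integral_density) (auto simp: has_bochner_integral_iff)
    finally show "integral\<^sup>L ?L (\<lambda>t. t ^ n) = integral\<^sup>L ?R (\<lambda>t. t ^ n)" .
  qed (fact L.real_distribution_axioms \<open>real_distribution ?R\<close>)+
  moreover have "distr M lborel Yinf = ?L"
    by (rule distr_cong) auto
  ultimately show ?thesis
    by (simp add: distributed_def flip: a_def b_def)
qed

end

subsection \<open>The algorithm as a function of the innovations\<close>

text \<open>The recursion is stated for a deterministic sequence \<open>u\<close>, so that the state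
  at time \<open>n\<close> is visibly a function of \<open>u 1, ..., u n\<close>.\<close>

primrec bandit_path :: "(nat \<Rightarrow> real) \<Rightarrow> real \<Rightarrow> (nat \<Rightarrow> real) \<Rightarrow> nat \<Rightarrow> real" where
  "bandit_path \<gamma> x u 0 = x"
| "bandit_path \<gamma> x u (Suc n) = bandit_path \<gamma> x u n
     + \<gamma> (Suc n) * ((if u (Suc n) \<le> bandit_path \<gamma> x u n then 1 else 0) - bandit_path \<gamma> x u n)"

text \<open>The index set \<open>I\<close> may be larger than \<open>{1..n}\<close> so that the
  induction hypothesis applies with the same product space.\<close>

lemma bandit_path_measurable:
  "{1..n} \<subseteq> I \<Longrightarrow> (\<lambda>u. bandit_path \<gamma> x u n) \<in> borel_measurable (PiM I (\<lambda>_. borel))"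
proof (induction n)
  case (Suc n)
  then have [measurable]: "(\<lambda>u. bandit_path \<gamma> x u n) \<in> borel_measurable (PiM I (\<lambda>_. borel))"
    by force
  have [measurable]: "(\<lambda>u. u (Suc n)) \<in> borel_measurable (PiM I (\<lambda>_. borel))"
    using Suc.prems by (intro measurable_component_singleton) auto
  show ?case
    unfolding bandit_path.simps by measurable
qed simp

lemma bandit_path_cong:
  "(\<And>k. k \<in> {1..n} \<Longrightarrow> u k = v k) \<Longrightarrow> bandit_path \<gamma> x u n = bandit_path \<gamma> x v n"
  by (induction n) auto

locale bandit_process = prob_space M + diverging_bandit_weights D
  for M :: "'a measure" and D :: "nat \<Rightarrow> real" +
  fixes U X :: "nat \<Rightarrow> 'a \<Rightarrow> real" and x :: real and Xinf :: "'a \<Rightarrow> real"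
  assumes iid: "iid_uniform M U"
    and x_bounds: "x \<in> {0..1}"
    and alg: "bandit_algorithm M (bandit_step D) U x X"
    and Xinf_measurable [measurable]: "Xinf \<in> borel_measurable M"
    and X_tendsto: "AE \<omega> in M. (\<lambda>n. X n \<omega>) \<longlonglongrightarrow> Xinf \<omega>"
begin

text \<open>A version of \<open>X\<close> that satisfies the initial condition and the recursion at
  every \<open>\<omega>\<close>, not just almost surely, and hence stays in the unit interval
  everywhere.\<close>

definition Z :: "nat \<Rightarrow> 'a \<Rightarrow> real" where
  "Z n \<omega> = bandit_path (bandit_step D) x (\<lambda>i. U i \<omega>) n"

lemma Z_Suc:
  "Z (Suc n) \<omega> = (if U (Suc n) \<omega> \<le> Z n \<omega> then Z n \<omega> + bandit_step D (Suc n) * (1 - Z n \<omega>)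
     else Z n \<omega> - bandit_step D (Suc n) * Z n \<omega>)"
  by (simp add: Z_def)

lemma Z_bounds: "Z n \<omega> \<in> {0..1}"
proof (induction n)
  case 0
  show ?case using x_bounds by (simp add: Z_def)
next
  case (Suc n)
  show ?case
    unfolding Z_Suc using step_up[OF Suc, of n] step_down[OF Suc, of n] by simp
qed

lemma X_eq_Z: "AE \<omega> in M. X n \<omega> = Z n \<omega>"
proof (induction n)
  case 0
  show ?case using alg by (simp add: bandit_algorithm_def Z_def)
next
  case (Suc n)
  have "AE \<omega> in M. X (Suc n) \<omega> =
      X n \<omega> + bandit_step D (Suc n) * (indicator {..X n \<omega>} (U (Suc n) \<omega>) - X n \<omega>)"
    using alg by (simp add: bandit_algorithm_def)
  with Suc show ?case
    by eventually_elim (simp add: Z_Suc indicator_def)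
qed

lemma Z_tendsto: "AE \<omega> in M. (\<lambda>n. Z n \<omega>) \<longlonglongrightarrow> Xinf \<omega>"
proof -
  have "AE \<omega> in M. \<forall>n. X n \<omega> = Z n \<omega>"
    using X_eq_Z by (simp add: AE_all_countable)
  with X_tendsto show ?thesis
    by eventually_elim simp
qed

text \<open>\<open>Z n\<close> depends only on the innovations with indices in
  \<open>{1..n}\<close>, a block disjoint from \<open>{Suc n}\<close>.\<close>

lemma indep_Z_U: "indep_var borel (Z n) borel (U (Suc n))"
proof -
  have "indep_vars (\<lambda>_. borel) U {1..}"
    using iid by (simp add: iid_uniform_def)
  then have "indep_var (PiM {1..n} (\<lambda>_. borel)) (\<lambda>\<omega>. restrict (\<lambda>i. U i \<omega>) {1..n})
      (PiM {Suc n} (\<lambda>_. borel)) (\<lambda>\<omega>. restrict (\<lambda>i. U i \<omega>) {Suc n})"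
    by (rule indep_var_restrict) auto
  then have "indep_var borel ((\<lambda>u. bandit_path (bandit_step D) x u n) \<circ> (\<lambda>\<omega>. restrict (\<lambda>i. U i \<omega>) {1..n}))
      borel ((\<lambda>u. u (Suc n)) \<circ> (\<lambda>\<omega>. restrict (\<lambda>i. U i \<omega>) {Suc n}))"
    by (rule indep_var_compose) (auto intro: bandit_path_measurable measurable_component_singleton)
  \<comment> \<open>Restricting the innovations to \<open>{1..n}\<close> does not change the path at
    time \<open>n\<close>.\<close>
  moreover have "(\<lambda>u. bandit_path (bandit_step D) x u n) \<circ> (\<lambda>\<omega>. restrict (\<lambda>i. U i \<omega>) {1..n}) = Z n"
    by (auto simp: fun_eq_iff Z_def intro!: bandit_path_cong)
  ultimately show ?thesis
    by (simp add: comp_def)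
qed

lemma Z_measurable [measurable]: "Z n \<in> borel_measurable M"
  using indep_Z_U[of n] by (simp add: indep_var_distribution_eq)

text \<open>With \<open>g\<close> the difference of \<open>h\<close> after a success and after a
  failure, \<open>h (Z (Suc n))\<close> is \<open>h\<close> after a failure plus the success
  indicator times \<open>g (Z n)\<close>. In expectation,
  \<open>expectation_uniform_le_indep\<close> replaces the indicator by \<open>Z n\<close>.\<close>

lemma Z_step:
  assumes h[measurable]: "h \<in> borel_measurable borel"
    and bound: "\<And>z. z \<in> {0..1} \<Longrightarrow> \<bar>h z\<bar> \<le> B"
  shows "expectation (\<lambda>\<omega>. h (Z (Suc n) \<omega>)) =
    expectation (\<lambda>\<omega>. Z n \<omega> * h (Z n \<omega> + bandit_step D (Suc n) * (1 - Z n \<omega>))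
      + (1 - Z n \<omega>) * h (Z n \<omega> - bandit_step D (Suc n) * Z n \<omega>))"
proof -
  let ?up = "\<lambda>z. z + bandit_step D (Suc n) * (1 - z)" and ?down = "\<lambda>z. z - bandit_step D (Suc n) * z"
  define g where "g = (\<lambda>z. h (?up z) - h (?down z))"
  have [measurable]: "U (Suc n) \<in> borel_measurable M"
    using indep_Z_U[of n] by (simp add: indep_var_distribution_eq)
  have g[measurable]: "g \<in> borel_measurable borel"
    unfolding g_def by measurable
  have g_bound: "\<bar>g z\<bar> \<le> 2 * B" if "z \<in> {0..1}" for z
    using bound[OF step_up[OF that, of n]] bound[OF step_down[OF that, of n]] by (simp add: g_def)
  have int_down: "integrable M (\<lambda>\<omega>. h (?down (Z n \<omega>)))"
    by (rule integrable_const_bound[where B = B])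
       (use bound[OF step_down[OF Z_bounds]] in auto)
  have int_g: "integrable M (\<lambda>\<omega>. g (Z n \<omega>))"
    by (rule integrable_const_bound[where B = "2 * B"]) (use g_bound[OF Z_bounds] in auto)
  have int_Ug: "integrable M (\<lambda>\<omega>. indicator {..Z n \<omega>} (U (Suc n) \<omega>) * g (Z n \<omega>))"
  proof (rule Bochner_Integration.integrable_bound[OF int_g])
    have "(\<lambda>\<omega>. (if U (Suc n) \<omega> \<le> Z n \<omega> then 1 else 0) * g (Z n \<omega>)) \<in> borel_measurable M"
      by measurable
    then show "(\<lambda>\<omega>. indicator {..Z n \<omega>} (U (Suc n) \<omega>) * g (Z n \<omega>)) \<in> borel_measurable M"
      by (simp add: indicator_def of_bool_def)
  qed (auto simp: indicator_def)
  have int_Zg: "integrable M (\<lambda>\<omega>. Z n \<omega> * g (Z n \<omega>))"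
    by (rule Bochner_Integration.integrable_bound[OF int_g])
       (use Z_bounds[of n] in \<open>simp_all add: abs_mult mult_left_le_one_le\<close>)
  have "expectation (\<lambda>\<omega>. h (Z (Suc n) \<omega>))
      = expectation (\<lambda>\<omega>. indicator {..Z n \<omega>} (U (Suc n) \<omega>) * g (Z n \<omega>) + h (?down (Z n \<omega>)))"
    by (intro Bochner_Integration.integral_cong) (auto simp: Z_Suc g_def indicator_def)
  also have "\<dots> = expectation (\<lambda>\<omega>. Z n \<omega> * g (Z n \<omega>)) + expectation (\<lambda>\<omega>. h (?down (Z n \<omega>)))"
    using expectation_uniform_le_indep[OF indep_Z_U _ Z_bounds g g_bound] iid
    by (simp add: Bochner_Integration.integral_add[OF int_Ug int_down] iid_uniform_def)
  also have "\<dots> = expectation (\<lambda>\<omega>. Z n \<omega> * g (Z n \<omega>) + h (?down (Z n \<omega>)))"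
    by (rule Bochner_Integration.integral_add[OF int_Zg int_down, symmetric])
  also have "\<dots> = expectation (\<lambda>\<omega>. Z n \<omega> * h (?up (Z n \<omega>)) + (1 - Z n \<omega>) * h (?down (Z n \<omega>)))"
    by (simp add: g_def algebra_simps)
  finally show ?thesis .
qed

sublocale success: urn_process M D Z x Xinf
  by unfold_locales (rule Z_measurable Z_bounds Z_step Xinf_measurable Z_tendsto | assumption | simp add: Z_def)+

text \<open>Exchanging the two colours: the map \<open>z \<mapsto> 1 - z\<close> swaps the upward
  and downward moves and their probabilities. The one-step relation for \<open>1 - Z\<close> is thus
  \<open>Z_step\<close> applied to \<open>\<lambda>z. h (1 - z)\<close>.\<close>

sublocale failure: urn_process M D "\<lambda>n \<omega>. 1 - Z n \<omega>" "1 - x" "\<lambda>\<omega>. 1 - Xinf \<omega>"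
proof
  show "(\<lambda>\<omega>. 1 - Z n \<omega>) \<in> borel_measurable M" for n
    by measurable
  show "(\<lambda>\<omega>. 1 - Xinf \<omega>) \<in> borel_measurable M"
    by measurable
  show "1 - Z 0 \<omega> = 1 - x" for \<omega>
    by (simp add: Z_def)
  show "1 - Z n \<omega> \<in> {0..1}" for n \<omega>
    using Z_bounds[of n \<omega>] by simp
  show "AE \<omega> in M. (\<lambda>n. 1 - Z n \<omega>) \<longlonglongrightarrow> 1 - Xinf \<omega>"
    using Z_tendsto by eventually_elim (intro tendsto_intros)
  fix n and h :: "real \<Rightarrow> real" and B :: real
  assume [measurable]: "h \<in> borel_measurable borel" and bound: "\<And>z. z \<in> {0..1} \<Longrightarrow> \<bar>h z\<bar> \<le> B"
  have "expectation (\<lambda>\<omega>. h (1 - Z (Suc n) \<omega>)) =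
      expectation (\<lambda>\<omega>. Z n \<omega> * h (1 - (Z n \<omega> + bandit_step D (Suc n) * (1 - Z n \<omega>)))
        + (1 - Z n \<omega>) * h (1 - (Z n \<omega> - bandit_step D (Suc n) * Z n \<omega>)))"
    by (rule Z_step[of "\<lambda>z. h (1 - z)" B]) (auto intro: bound)
  then show "expectation (\<lambda>\<omega>. h (1 - Z (Suc n) \<omega>)) =
      expectation (\<lambda>\<omega>. (1 - Z n \<omega>) * h (1 - Z n \<omega> + bandit_step D (Suc n) * (1 - (1 - Z n \<omega>)))
        + (1 - (1 - Z n \<omega>)) * h (1 - Z n \<omega> - bandit_step D (Suc n) * (1 - Z n \<omega>)))"
    by (simp add: algebra_simps)
qed

end

lemma bandit_step_const:
  assumes "D 0 = 1" "\<And>k. k \<ge> 1 \<Longrightarrow> D k = \<delta>" "n \<ge> 1"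
  shows "bandit_step D n = \<delta> / (real n * \<delta> + 1)"
  using assms by (simp add: bandit_step_def bandit_S_def sum.atLeast_Suc_atMost[of 0] add.commute)

theorem proposition6:
  fixes M :: "'a measure"
    and U X :: "nat \<Rightarrow> 'a \<Rightarrow> real"
    and Xinf :: "'a \<Rightarrow> real"
    and \<Delta> :: "nat \<Rightarrow> real"
    and x :: real
  assumes "prob_space M"
    and "iid_uniform M U"
    and "\<Delta> 0 = 1"
    and "\<And>n. n \<ge> 1 \<Longrightarrow> \<Delta> n > 0"
    and "filterlim (\<lambda>n. \<Sum>k=1..n. bandit_step \<Delta> k) at_top sequentially"
    and "antimono_on {1..} \<Delta>"
    and "0 \<le> x" and "x \<le> 1"
    and "bandit_algorithm M (bandit_step \<Delta>) U x X"
    and "Xinf \<in> borel_measurable M"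
    and "AE \<omega> in M. (\<lambda>n. X n \<omega>) \<longlonglongrightarrow> Xinf \<omega>"
  shows
    "(\<forall>m\<ge>1.
        prob_space.expectation M (\<lambda>\<omega>. Xinf \<omega> ^ (m + 1))
          \<le> (\<Prod>k=0..m. 1 - (1 - x) / bandit_S \<Delta> k) \<and>
        prob_space.expectation M (\<lambda>\<omega>. (1 - Xinf \<omega>) ^ (m + 1))
          \<le> (\<Prod>k=0..m. 1 - x / bandit_S \<Delta> k)) \<and>
     (0 < x \<and> x < 1 \<longrightarrow>
        prob_space.prob M {\<omega> \<in> space M. Xinf \<omega> = 1}
          \<le> (INF m::nat. prob_space.expectation M (\<lambda>\<omega>. Xinf \<omega> ^ m)) \<and>
        (INF m::nat. prob_space.expectation M (\<lambda>\<omega>. Xinf \<omega> ^ m)) = 0 \<and>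
        prob_space.prob M {\<omega> \<in> space M. Xinf \<omega> = 0}
          \<le> (INF m::nat. prob_space.expectation M (\<lambda>\<omega>. (1 - Xinf \<omega>) ^ m)) \<and>
        (INF m::nat. prob_space.expectation M (\<lambda>\<omega>. (1 - Xinf \<omega>) ^ m)) = 0) \<and>
     (\<forall>\<delta>>0. (\<forall>n\<ge>1. \<Delta> n = \<delta>) \<longrightarrow>
        (\<forall>n\<ge>1. bandit_step \<Delta> n = \<delta> / (real n * \<delta> + 1)) \<and>
        (0 < x \<and> x < 1 \<longrightarrow>
          distributed M lborel Xinf (\<lambda>t. ennreal (beta_density (x / \<delta>) ((1 - x) / \<delta>) t))))"
proof -
  interpret prob_space M by fact
  interpret bandit_process M \<Delta> U X x Xinf
    using assms by unfold_locales auto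
  have moments: "expectation (\<lambda>\<omega>. Xinf \<omega> ^ (m + 1)) \<le> (\<Prod>k=0..m. 1 - (1 - x) / bandit_S \<Delta> k) \<and>
      expectation (\<lambda>\<omega>. (1 - Xinf \<omega>) ^ (m + 1)) \<le> (\<Prod>k=0..m. 1 - x / bandit_S \<Delta> k)" for m
    using success.moment_le[of m] failure.moment_le[of m] by simp
  have prob_1: "prob {\<omega> \<in> space M. Xinf \<omega> = 1} \<le> (INF m. expectation (\<lambda>\<omega>. Xinf \<omega> ^ m))"
    by (rule success.prob_limit_eq_1_le)
  have prob_0: "prob {\<omega> \<in> space M. Xinf \<omega> = 0} \<le> (INF m. expectation (\<lambda>\<omega>. (1 - Xinf \<omega>) ^ m))"
    using failure.prob_limit_eq_1_le by simp
  have INF_1: "(INF m. expectation (\<lambda>\<omega>. Xinf \<omega> ^ m)) = 0" if "0 < x \<and> x < 1"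
    by (rule success.INF_moments_eq_0) (use that in auto)
  have INF_0: "(INF m. expectation (\<lambda>\<omega>. (1 - Xinf \<omega>) ^ m)) = 0" if "0 < x \<and> x < 1"
    by (rule failure.INF_moments_eq_0) (use that in auto)
  have step: "bandit_step \<Delta> n = \<delta> / (real n * \<delta> + 1)" if "\<forall>n\<ge>1. \<Delta> n = \<delta>" "n \<ge> 1" for \<delta> n
    by (rule bandit_step_const) (use that assms(3) in auto)
  have beta: "distributed M lborel Xinf (\<lambda>t. ennreal (beta_density (x / \<delta>) ((1 - x) / \<delta>) t))"
    if "\<forall>n\<ge>1. \<Delta> n = \<delta>" "0 < x \<and> x < 1" for \<delta>
    by (rule success.limit_beta_distributed) (use that in auto)
  show ?thesis
    by (intro conjI allI impI) (rule moments[THEN conjunct1] moments[THEN conjunct2] prob_1 prob_0 INF_1 INF_0 step beta; assumption)+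
qed

end
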